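(* Let $G$ be a connected block graph of order $n$. Then $M_G\geq \frac{n+2}{3}$, with equality if and only if $G\cong P_n$. In other words, the path $P_n$ is the unique (up to isomorphism) connected block graph of order $n$ having minimum mean CIS order, and this minimum is $\frac{n+2}{3}$.
   Context: Graphs are finite, simple and undirected. The order of a graph is its number of vertices, and $P_n$ is the path of order $n$. A block graph is a graph in which every block is a complete graph. For a graph $G$, let $\mathcal{C}_G$ be the collection of connected induced subgraphs of $G$ (on nonempty vertex sets). Put $N_G=|\mathcal{C}_G|$ and $W_G=\sum_{H\in\mathcal{C}_G}|V(H)|$. The mean CIS (connected induced subgraph) order of $G$ is $M_G=W_G/N_G$. *)

theory Defs
  imports Complex_Main "Graph_Theory.Graph_Theory"
begin

text \<open>
  A finite simple undirected graph is a digraph satisfying the locale predicate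
  \<^const>\<open>graph\<close>: finite, without loops or parallel arcs, and symmetric, so that an
  undirected edge is a pair of opposite arcs.  The predicate
  \<^const>\<open>Digraph_Component.connected\<close> excludes the graph without vertices.
\<close>

text \<open>A cut vertex separates two other vertices of the same component.\<close>

definition cut_vertex :: "('a, 'b) pre_digraph \<Rightarrow> 'a \<Rightarrow> bool" where
  "cut_vertex H v \<longleftrightarrow> v \<in> verts H \<and>
     (\<exists>u \<in> verts H - {v}. \<exists>w \<in> verts H - {v}.
        u \<rightarrow>\<^sup>*\<^bsub>H\<^esub> w \<and> \<not> u \<rightarrow>\<^sup>*\<^bsub>pre_digraph.del_vert H v\<^esub> w)"

text \<open>
  A block is a maximal connected subgraph that has no cut vertex of its own.  Subgraphs of
  digraphs need not be symmetric, hence the conjunct \<^term>\<open>graph H\<close>.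
\<close>

definition block :: "('a, 'b) pre_digraph \<Rightarrow> ('a, 'b) pre_digraph \<Rightarrow> bool" where
  "block G = pre_digraph.max_subgraph G
     (\<lambda>H. graph H \<and> Digraph_Component.connected H \<and> (\<forall>v. \<not> cut_vertex H v))"

definition block_graph :: "('a, 'b) pre_digraph \<Rightarrow> bool" where
  "block_graph G \<longleftrightarrow> graph G \<and> (\<forall>B. block G B \<longrightarrow> complete_digraph (card (verts B)) B)"

definition cis :: "('a, 'b) pre_digraph \<Rightarrow> ('a, 'b) pre_digraph set" where
  "cis G = {H. induced_subgraph H G \<and> Digraph_Component.connected H}"

definition cis_number :: "('a, 'b) pre_digraph \<Rightarrow> nat" where
  "cis_number G = card (cis G)"

definition cis_weight :: "('a, 'b) pre_digraph \<Rightarrow> nat" where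
  "cis_weight G = (\<Sum>H \<in> cis G. card (verts H))"

definition mean_cis_order :: "('a, 'b) pre_digraph \<Rightarrow> real" where
  "mean_cis_order G = real (cis_weight G) / real (cis_number G)"

definition path_graph :: "nat \<Rightarrow> (nat, nat \<times> nat) pre_digraph" where
  "path_graph n = with_proj \<lparr> pverts = {..<n},
     parcs = {(i, j). i < n \<and> j < n \<and> (j = Suc i \<or> i = Suc j)} \<rparr>"

end

theory Submission
  imports Defs
begin

text \<open>
  The argument uses only that $G$ is connected.  Multiplying out, the inequality says
  $\sum_S (n - |S|) \le 2 \sum_T (|T| - 1)$, both sums over the connected vertex sets.  The left side
  counts pairs $(S, x)$ with $x \notin S$.  Send $(S, x)$ to $(T, S)$ for a minimal connected set $T$
  containing $S$ and $x$.  Some vertex of $T - S$ can be removed from $T$ without disconnecting it, and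
  by minimality it is $x$; so the map is injective.  By minimality $T - S$ is a path leading from $S$
  to $x$, so $S$ is a component of $T - p$ for some $p$, and $T - p$ has at most two components.  Hence
  every $p \in T$ accounts for at most two sets $S$, and for only one if it is not a cut vertex of
  $T$; as $T$ has two vertices that are not cut vertices (if $|T| > 1$), it is hit at most
  $2 (|T| - 1)$ times.  Equality for $T = V(G)$ leaves only two non-cut vertices, which forces a path.
\<close>

subsection \<open>Connected sets of a symmetric relation\<close>

text \<open>Connectivity is phrased through cuts instead of walks. For symmetric \<open>E\<close> it
  says that the graph induced on \<open>S\<close> is connected; the empty set is excluded, as it is
  for \<open>Digraph_Component.connected\<close>.\<close>

definition conn_set :: "('a \<times> 'a) set \<Rightarrow> 'a set \<Rightarrow> bool" where
  "conn_set E S \<longleftrightarrow> S \<noteq> {} \<and>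
     (\<forall>A. A \<subseteq> S \<and> A \<noteq> {} \<and> (\<forall>a\<in>A. \<forall>b\<in>S - A. (a, b) \<notin> E) \<longrightarrow> A = S)"

lemma conn_set_nonempty: "conn_set E S \<Longrightarrow> S \<noteq> {}"
  by (simp add: conn_set_def)

lemma not_conn_set_empty [simp]: "\<not> conn_set E {}"
  by (simp add: conn_set_def)

text \<open>Closure principle through which connectivity is applied. \<open>A\<close> may be any
  set, so one closed set can be tested against several connected sets.\<close>

lemma conn_set_closed:
  assumes "conn_set E S" "A \<inter> S \<noteq> {}" "\<And>a b. a \<in> A \<inter> S \<Longrightarrow> b \<in> S - A \<Longrightarrow> (a, b) \<notin> E"
  shows "S \<subseteq> A"
proof -
  have "A \<inter> S \<subseteq> S \<and> A \<inter> S \<noteq> {} \<and> (\<forall>a\<in>A \<inter> S. \<forall>b\<in>S - A \<inter> S. (a, b) \<notin> E)"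
    using assms(2,3) by auto
  then have "A \<inter> S = S" using assms(1) unfolding conn_set_def by blast
  then show ?thesis by auto
qed

lemma conn_set_edge:
  assumes "conn_set E S" "A \<subseteq> S" "A \<noteq> {}" "A \<noteq> S"
  obtains a b where "a \<in> A" "b \<in> S - A" "(a, b) \<in> E"
  using assms unfolding conn_set_def by blast

lemma conn_set_singleton [simp]: "conn_set E {x}"
  by (auto simp: conn_set_def)

text \<open>A closed set that meets \<open>A\<close> contains \<open>A\<close>, and likewise for
  \<open>B\<close>; the pair \<open>a\<close>, \<open>b\<close> carries it from one to the
  other.\<close>

lemma conn_set_Un:
  assumes "sym E" "conn_set E A" "conn_set E B" "a \<in> A" "b \<in> B" "a = b \<or> (a, b) \<in> E"
  shows "conn_set E (A \<union> B)"
  unfolding conn_set_def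
proof (intro conjI allI impI)
  show "A \<union> B \<noteq> {}" using assms by auto
  fix C
  assume C: "C \<subseteq> A \<union> B \<and> C \<noteq> {} \<and> (\<forall>c\<in>C. \<forall>d\<in>A \<union> B - C. (c, d) \<notin> E)"
  have A: "A \<subseteq> C" if "C \<inter> A \<noteq> {}" using conn_set_closed[OF assms(2) that] C by auto
  have B: "B \<subseteq> C" if "C \<inter> B \<noteq> {}" using conn_set_closed[OF assms(3) that] C by auto
  have "(b, a) \<in> E \<or> a = b" using assms(1,6) by (auto dest: symD)
  then have "a \<in> C \<longleftrightarrow> b \<in> C" using assms(4-6) C by blast
  then show "C = A \<union> B" using A B C assms(4,5) by blast
qed

lemma conn_set_insert:
  assumes "sym E" "conn_set E S" "s \<in> S" "(s, z) \<in> E"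
  shows "conn_set E (insert z S)"
  using conn_set_Un[OF assms(1,2) conn_set_singleton[of E z] assms(3)] assms(4) by simp

text \<open>\<open>C\<close> is the union of all connected subsets of \<open>R\<close> containing
  \<open>x\<close>. It is connected because they share \<open>x\<close>, and no edge leaves it
  within \<open>R\<close> because a neighbour could be added to one of them.\<close>

lemma component_exists:
  assumes "sym E" "x \<in> R"
  obtains C where "conn_set E C" "x \<in> C" "C \<subseteq> R" "\<And>c b. c \<in> C \<Longrightarrow> b \<in> R - C \<Longrightarrow> (c, b) \<notin> E"
proof -
  let ?F = "{D. conn_set E D \<and> x \<in> D \<and> D \<subseteq> R}"
  have x: "x \<in> \<Union>?F" using assms(2) by (auto intro!: exI[of _ "{x}"])
  have 1: "\<Union>?F \<subseteq> R" by auto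
  have 2: "conn_set E (\<Union>?F)"
  proof (subst conn_set_def, intro conjI allI impI)
    show "\<Union>?F \<noteq> {}" using x by blast
    fix A assume A: "A \<subseteq> \<Union>?F \<and> A \<noteq> {} \<and> (\<forall>a\<in>A. \<forall>b\<in>\<Union>?F - A. (a, b) \<notin> E)"
    have D: "D \<subseteq> A" if "D \<in> ?F" "A \<inter> D \<noteq> {}" for D
      using conn_set_closed[of E D A] that A by blast
    obtain D where "D \<in> ?F" "A \<inter> D \<noteq> {}" using A by blast
    then have "x \<in> A" using D by blast
    then have "D \<subseteq> A" if "D \<in> ?F" for D using D that by blast
    then show "A = \<Union>?F" using A by blast
  qed
  have "(c, b) \<notin> E" if c: "c \<in> \<Union>?F" and b: "b \<in> R - \<Union>?F" for c b
  proof -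
    from c obtain D where D: "D \<in> ?F" "c \<in> D" by blast
    show "(c, b) \<notin> E"
    proof
      assume "(c, b) \<in> E"
      then have "insert b D \<in> ?F" using conn_set_insert[OF assms(1) _ D(2)] D(1) b by auto
      then show False using b by blast
    qed
  qed
  then show thesis using that[OF 2 x 1] by blast
qed

text \<open>Grow \<open>S\<close> inside \<open>T\<close> by one neighbouring vertex at a time; the
  last vertex to be added can be removed from \<open>T\<close>.\<close>

lemma conn_set_remove:
  assumes "sym E" "finite T" "conn_set E T" "conn_set E S" "S \<subset> T"
  shows "\<exists>z\<in>T - S. conn_set E (T - {z})"
  using assms(4,5)
proof (induction "card (T - S)" arbitrary: S rule: less_induct)
  case less
  obtain s z where z: "s \<in> S" "z \<in> T - S" "(s, z) \<in> E"
    using conn_set_edge[OF assms(3), of S] less.prems conn_set_nonempty by blast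
  have c: "conn_set E (insert z S)" using conn_set_insert[OF assms(1) less.prems(1) z(1,3)] .
  show ?case
  proof (cases "insert z S = T")
    case True
    then have "T - {z} = S" using z by auto
    then show ?thesis using z less.prems by auto
  next
    case False
    have "card (T - insert z S) < card (T - S)"
      using z assms(2) by (intro psubset_card_mono) auto
    then show ?thesis using less.hyps[OF _ c] False z less.prems by blast
  qed
qed

text \<open>Since the empty set is not connected, a single-vertex set has no vertex that is non-cut
  in this sense.\<close>

definition noncut :: "('a \<times> 'a) set \<Rightarrow> 'a set \<Rightarrow> 'a set" where
  "noncut E T = {p \<in> T. conn_set E (T - {p})}"

lemma finite_noncut: "finite T \<Longrightarrow> finite (noncut E T)"
  by (simp add: noncut_def)

text \<open>Growing \<open>{v}\<close> inside \<open>T\<close> leaves a removable vertex other than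
  \<open>v\<close>. Applied first to any vertex and then to the vertex found, this gives
  two.\<close>

lemma card_noncut_ge_2:
  assumes "sym E" "finite T" "conn_set E T" "card T \<ge> 2"
  shows "card (noncut E T) \<ge> 2"
proof -
  have rem: "\<exists>z\<in>T - {v}. z \<in> noncut E T" if "v \<in> T" for v
  proof -
    have "{v} \<subset> T" using that assms(4) by (auto simp: psubset_eq)
    then show ?thesis using conn_set_remove[OF assms(1-3), of "{v}"] by (auto simp: noncut_def)
  qed
  obtain v where "v \<in> T" using conn_set_nonempty[OF assms(3)] by blast
  then obtain z where z: "z \<in> T" "z \<in> noncut E T" using rem by blast
  then obtain y where y: "y \<noteq> z" "y \<in> noncut E T" using rem by blast
  have "card {y, z} \<le> card (noncut E T)"
    using y z finite_noncut[OF assms(2)] by (intro card_mono) auto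
  then show ?thesis using y by simp
qed

subsection \<open>Counting the sides of a connected set\<close>

text \<open>For symmetric \<open>E\<close> these are the components of \<open>T - {p}\<close>,
  provided there are at most two of them; with three or more the set is empty.\<close>

definition sides :: "('a \<times> 'a) set \<Rightarrow> 'a set \<Rightarrow> 'a \<Rightarrow> 'a set set" where
  "sides E T p = {S. conn_set E S \<and> S \<subseteq> T - {p} \<and>
     (T - {p} - S = {} \<or> conn_set E (T - {p} - S)) \<and> (\<forall>s\<in>S. \<forall>d\<in>T - {p} - S. (s, d) \<notin> E)}"

lemma sides_connected:
  assumes "conn_set E (T - {p})"
  shows "sides E T p \<subseteq> {T - {p}}"
proof
  fix S assume S: "S \<in> sides E T p"
  then have "S \<noteq> {}" "S \<subseteq> T - {p}" by (auto simp: sides_def conn_set_nonempty)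
  moreover from this have "T - {p} \<subseteq> S"
    using conn_set_closed[OF assms, of S] S by (auto simp: sides_def)
  ultimately show "S \<in> {T - {p}}" by auto
qed

text \<open>Two sides that meet contain each other, each being connected and closed in
  \<open>T - {p}\<close>. A side disjoint from \<open>S\<close> lies in the rest, which is connected
  and hence equal to it.\<close>

lemma sides_eq:
  assumes "sym E" "S \<in> sides E T p" "S' \<in> sides E T p"
  shows "S' = S \<or> S' = T - {p} - S"
proof -
  have *: "B \<subseteq> A" if "A \<in> sides E T p" "B \<in> sides E T p" "A \<inter> B \<noteq> {}" for A B
    using conn_set_closed[of E B A] that by (auto simp: sides_def)
  show ?thesis
  proof (cases "S \<inter> S' = {}")
    case False
    then show ?thesis using *[OF assms(2,3)] *[OF assms(3,2)] by auto
  next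
    case True
    let ?D = "T - {p} - S"
    have S': "S' \<subseteq> ?D" "S' \<noteq> {}" using True assms(3) by (auto simp: sides_def conn_set_nonempty)
    then have "conn_set E ?D" using assms(2) by (auto simp: sides_def)
    then have "?D \<subseteq> S'" using conn_set_closed[of E ?D S'] S' assms(3) by (auto simp: sides_def)
    then show ?thesis using S' by blast
  qed
qed

lemma card_sides_le:
  assumes "sym E"
  shows "card (sides E T p) \<le> (if conn_set E (T - {p}) then 1 else 2)"
proof (cases "sides E T p = {}")
  case False
  then obtain S where "S \<in> sides E T p" by blast
  then have "sides E T p \<subseteq> {S, T - {p} - S}" using sides_eq[OF assms] by blast
  then have "card (sides E T p) \<le> card {S, T - {p} - S}" by (intro card_mono) auto
  also have "\<dots> \<le> 2" by (simp add: card_insert_if)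
  finally have "card (sides E T p) \<le> 2" .
  moreover have "card (sides E T p) \<le> 1" if "conn_set E (T - {p})"
    using card_mono[OF _ sides_connected[OF that]] by simp
  ultimately show ?thesis by simp
qed simp

text \<open>Each vertex contributes at most two sides, a non-cut vertex at most one. The second
  bound uses that there are two non-cut vertices; the first is kept for the equality case.\<close>

lemma card_sides_Union:
  assumes "sym E" "finite T" "conn_set E T"
  shows "card (\<Union>p\<in>T. sides E T p) + card (noncut E T) \<le> 2 * card T"
    and "card (\<Union>p\<in>T. sides E T p) \<le> 2 * (card T - 1)"
proof -
  have "card (\<Union>p\<in>T. sides E T p) \<le> (\<Sum>p\<in>T. card (sides E T p))"
    using assms(2) by (rule card_UN_le)
  also have "\<dots> \<le> (\<Sum>p\<in>T. if conn_set E (T - {p}) then 1 else 2)"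
    by (intro sum_mono card_sides_le assms(1))
  finally have "card (\<Union>p\<in>T. sides E T p) \<le> (\<Sum>p\<in>T. if conn_set E (T - {p}) then 1 else 2)" .
  moreover have "card (noncut E T) = (\<Sum>p\<in>T. if conn_set E (T - {p}) then 1 else 0)"
    using assms(2) by (simp add: noncut_def sum.If_cases Int_def)
  moreover have "(\<Sum>p\<in>T. if conn_set E (T - {p}) then 1 else 2)
      + (\<Sum>p\<in>T. if conn_set E (T - {p}) then 1 else 0) = (\<Sum>p\<in>T. 2::nat)"
    unfolding sum.distrib[symmetric] by (intro sum.cong) auto
  ultimately show 1: "card (\<Union>p\<in>T. sides E T p) + card (noncut E T) \<le> 2 * card T" by simp
  show "card (\<Union>p\<in>T. sides E T p) \<le> 2 * (card T - 1)"
  proof (cases "card T \<ge> 2")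
    case True
    then show ?thesis using 1 card_noncut_ge_2[OF assms] by linarith
  next
    \<comment> \<open>A single vertex is not non-cut, but there is no side either, because
      \<open>T - {p}\<close> is empty.\<close>
    case False
    have "card T \<noteq> 0" using assms(2,3) conn_set_nonempty by auto
    then have "card T = 1" using False by linarith
    then obtain v where "T = {v}" by (auto simp: card_1_singleton_iff)
    then have "(\<Union>p\<in>T. sides E T p) = {}" by (auto simp: sides_def conn_set_nonempty)
    then show ?thesis by simp
  qed
qed

section \<open>Minimal connected sets joining a set to a vertex\<close>

definition min_conn :: "('a \<times> 'a) set \<Rightarrow> 'a set \<Rightarrow> 'a \<Rightarrow> 'a set \<Rightarrow> bool" where
  "min_conn E S x T \<longleftrightarrow> conn_set E T \<and> insert x S \<subseteq> T \<and>
     (\<forall>T'. conn_set E T' \<and> insert x S \<subseteq> T' \<and> T' \<subseteq> T \<longrightarrow> T' = T)"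

lemma min_conn_exists:
  assumes "finite V" "conn_set E V" "insert x S \<subseteq> V"
  shows "\<exists>T. min_conn E S x T \<and> T \<subseteq> V"
proof -
  let ?F = "{T. T \<subseteq> V \<and> conn_set E T \<and> insert x S \<subseteq> T}"
  have "finite ?F" using assms(1) by simp
  moreover have "V \<in> ?F" using assms by auto
  ultimately obtain T where T: "T \<in> ?F" "\<And>T'. T' \<in> ?F \<Longrightarrow> T' \<subseteq> T \<Longrightarrow> T' = T"
    using finite_has_minimal[of ?F] by (metis (no_types, lifting) empty_iff)
  have "T' = T" if "conn_set E T'" "insert x S \<subseteq> T'" "T' \<subseteq> T" for T'
    using T(2)[of T'] T(1) that by auto
  then have "min_conn E S x T" using T(1) by (simp add: min_conn_def)
  then show ?thesis using T(1) by auto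
qed

text \<open>Injectivity of the count: a vertex \<open>z\<close> of \<open>T - S\<close> that can be
  removed from \<open>T\<close> must be \<open>x\<close>, since otherwise \<open>T - {z}\<close>
  would contradict minimality; for the same reason it is \<open>y\<close>.\<close>

lemma min_conn_unique:
  assumes "sym E" "finite T" "conn_set E S"
    and "min_conn E S x T" "x \<notin> S" "min_conn E S y T" "y \<notin> S"
  shows "x = y"
proof -
  have "conn_set E T" "S \<subset> T" using assms(4,5) by (auto simp: min_conn_def)
  then obtain z where z: "z \<in> T - S" "conn_set E (T - {z})"
    using conn_set_remove[OF assms(1,2) _ assms(3)] by blast
  have "z = w" if "min_conn E S w T" for w
  proof (rule ccontr)
    assume "z \<noteq> w"
    then have "insert w S \<subseteq> T - {z}" using that z by (auto simp: min_conn_def)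
    then have "T - {z} = T" using that z(2) unfolding min_conn_def by blast
    then show False using z by auto
  qed
  then show ?thesis using assms(4,6) by blast
qed

text \<open>By minimality \<open>T - S\<close> is connected and exactly one of its vertices,
  \<open>p\<close>, has a neighbour in \<open>S\<close>. Deleting \<open>p\<close> separates
  \<open>S\<close> from what remains of \<open>T - S\<close>, which is empty or connected.\<close>

lemma min_conn_side:
  assumes "sym E" "conn_set E S" "min_conn E S x T" "x \<notin> S"
  shows "\<exists>p\<in>T. S \<in> sides E T p"
proof -
  let ?R = "T - S"
  have T: "conn_set E T" "S \<subseteq> T" "x \<in> T" using assms(3) by (auto simp: min_conn_def)
  have R: "x \<in> ?R" using T assms(4) by blast
  \<comment> \<open>Minimality in usable form: \<open>D\<close> and \<open>S\<close> together form a
    connected set containing \<open>x\<close>, so they exhaust \<open>T\<close>.\<close>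
  have full: "D = ?R"
    if "conn_set E D" "x \<in> D" "D \<subseteq> ?R" "d \<in> D" "s \<in> S" "(d, s) \<in> E" for D d s
  proof -
    have "conn_set E (D \<union> S)"
      using conn_set_Un[OF assms(1) that(1) assms(2) that(4,5)] that(6) by blast
    moreover have "insert x S \<subseteq> D \<union> S" "D \<union> S \<subseteq> T" using that T by auto
    ultimately have "D \<union> S = T" using assms(3) unfolding min_conn_def by blast
    then show ?thesis using that(3) by blast
  qed
  have "S \<noteq> {}" using assms(2) by (rule conn_set_nonempty)
  \<comment> \<open>\<open>D0\<close> is the component of \<open>x\<close> in \<open>T - S\<close>.
    As \<open>T\<close> is connected, an edge must leave it, and that edge can only end in
    \<open>S\<close>.\<close>
  obtain D0 where D0: "conn_set E D0" "x \<in> D0" "D0 \<subseteq> ?R"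
      "\<And>c b. c \<in> D0 \<Longrightarrow> b \<in> ?R - D0 \<Longrightarrow> (c, b) \<notin> E"
    using component_exists[OF assms(1) R] by metis
  have "D0 \<subseteq> T" "D0 \<noteq> {}" "D0 \<noteq> T" using D0 T \<open>S \<noteq> {}\<close> by auto
  then obtain p s where ps: "p \<in> D0" "s \<in> T - D0" "(p, s) \<in> E"
    using conn_set_edge[OF T(1)] by metis
  then have "s \<in> S" using D0(4) by blast
  then have "D0 = ?R" using full[OF D0(1-3) ps(1)] ps(3) by blast
  then have Rc: "conn_set E ?R" and p: "p \<in> ?R" using D0 ps by auto
  have "S \<in> sides E T p"
  proof (cases "p = x")
    case True
    have "{x} = ?R" using full[of "{x}" x s] R ps True \<open>s \<in> S\<close> by auto
    then have "T - {p} - S = {}" "S \<subseteq> T - {p}" using True T by auto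
    then show ?thesis using assms(2) by (auto simp: sides_def)
  next
    case False
    then have "x \<in> ?R - {p}" using R by blast
    \<comment> \<open>\<open>D\<close> is the component of \<open>x\<close> after deletion of
      \<open>p\<close>. Connectivity of \<open>T - S\<close> forces an edge from \<open>D\<close> to
      \<open>p\<close>, so \<open>D\<close> with \<open>p\<close> is connected, touches
      \<open>S\<close> and is all of \<open>T - S\<close>.\<close>
    then obtain D where D: "conn_set E D" "x \<in> D" "D \<subseteq> ?R - {p}"
        "\<And>c b. c \<in> D \<Longrightarrow> b \<in> ?R - {p} - D \<Longrightarrow> (c, b) \<notin> E"
      using component_exists[OF assms(1)] by metis
    have "D \<subseteq> ?R" "D \<noteq> {}" "D \<noteq> ?R" using D p by auto
    then obtain d b where db: "d \<in> D" "b \<in> ?R - D" "(d, b) \<in> E"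
      using conn_set_edge[OF Rc] by metis
    then have "b = p" using D(4) by blast
    then have "conn_set E (insert p D)" using conn_set_insert[OF assms(1) D(1) db(1)] db(3) by simp
    then have "insert p D = ?R" using full[of "insert p D" p s] D p ps \<open>s \<in> S\<close> by auto
    then have eq: "T - {p} - S = D" using D(3) by blast
    \<comment> \<open>An edge between \<open>S\<close> and \<open>D\<close> would make
      \<open>D\<close> alone equal to \<open>T - S\<close>, although \<open>p\<close> is missing
      from it.\<close>
    have "(s', d') \<notin> E" if "s' \<in> S" "d' \<in> D" for s' d'
    proof
      assume "(s', d') \<in> E"
      then have "(d', s') \<in> E" using assms(1) by (auto dest: symD)
      then have "D = ?R" using full[OF D(1,2) _ that(2,1)] D(3) by blast
      then show False using D(3) p by blast
    qed
    then show ?thesis using assms(2) D(1) T p by (auto simp: sides_def eq)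
  qed
  then show ?thesis using p by blast
qed

section \<open>Double counting over all connected sets\<close>

definition conn_sets :: "('a \<times> 'a) set \<Rightarrow> 'a set \<Rightarrow> 'a set set" where
  "conn_sets E V = {S. S \<subseteq> V \<and> conn_set E S}"

lemma finite_conn_sets: "finite V \<Longrightarrow> finite (conn_sets E V)"
  by (simp add: conn_sets_def)

text \<open>Both sums are sizes of sets of pairs: \<open>(S, x)\<close> with \<open>x\<close>
  outside \<open>S\<close>, and \<open>(T, S)\<close> with \<open>S\<close> a side at some vertex of
  \<open>T\<close>. Minimal connected sets inject the first into the second.\<close>

lemma sum_complements_le:
  assumes "sym E" "finite V" "conn_set E V"
  shows "(\<Sum>S\<in>conn_sets E V. card (V - S)) \<le> (\<Sum>T\<in>conn_sets E V. card (\<Union>p\<in>T. sides E T p))"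
proof -
  let ?C = "conn_sets E V"
  have "\<exists>T. min_conn E S x T \<and> T \<subseteq> V" if "S \<in> ?C" "x \<in> V - S" for S x
    using min_conn_exists[OF assms(2,3)] that by (auto simp: conn_sets_def)
  \<comment> \<open>There may be several minimal connected sets for one pair; any choice gives an
    injection.\<close>
  then obtain t where t: "\<And>S x. S \<in> ?C \<Longrightarrow> x \<in> V - S \<Longrightarrow> min_conn E S x (t S x) \<and> t S x \<subseteq> V"
    by metis
  let ?A = "Sigma ?C (\<lambda>S. V - S)" and ?B = "Sigma ?C (\<lambda>T. \<Union>p\<in>T. sides E T p)"
  let ?f = "\<lambda>(S, x). (t S x, S)"
  have fin: "finite T" if "T \<in> ?C" for T
    using that assms(2) finite_subset by (auto simp: conn_sets_def)
  have finU: "finite (\<Union>p\<in>T. sides E T p)" if "T \<in> ?C" for T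
  proof -
    have "(\<Union>p\<in>T. sides E T p) \<subseteq> Pow T" by (auto simp: sides_def)
    then show ?thesis using fin[OF that] finite_subset by blast
  qed
  have "inj_on ?f ?A"
  proof (rule inj_onI)
    fix a b assume ab: "a \<in> ?A" "b \<in> ?A" "?f a = ?f b"
    obtain S x where a: "a = (S, x)" by force
    from ab(3) obtain y where b: "b = (S, y)" "t S y = t S x" unfolding a by (cases b) auto
    have S: "S \<in> ?C" "x \<in> V - S" "y \<in> V - S" using ab a b by auto
    have "x = y"
    proof (rule min_conn_unique[OF assms(1)])
      show "finite (t S x)" using t[OF S(1,2)] assms(2) finite_subset by blast
      show "conn_set E S" using S by (simp add: conn_sets_def)
      show "min_conn E S x (t S x)" "min_conn E S y (t S x)"
        using t[OF S(1,2)] t[OF S(1,3)] b(2) by simp_all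
    qed (use S in auto)
    then show "a = b" using a b by simp
  qed
  moreover have "?f ` ?A \<subseteq> ?B"
  proof
    fix q assume "q \<in> ?f ` ?A"
    then obtain S x where q: "q = (t S x, S)" "S \<in> ?C" "x \<in> V - S" by auto
    have m: "min_conn E S x (t S x)" "t S x \<subseteq> V" using t q by auto
    then have "t S x \<in> ?C" by (auto simp: min_conn_def conn_sets_def)
    moreover have "\<exists>p\<in>t S x. S \<in> sides E (t S x) p"
      using min_conn_side[OF assms(1) _ m(1)] q by (auto simp: conn_sets_def)
    ultimately show "q \<in> ?B" using q by auto
  qed
  moreover have "finite ?B" using finite_conn_sets[OF assms(2)] finU by blast
  ultimately have "card ?A \<le> card ?B" by (rule card_inj_on_le)
  moreover have "card ?A = (\<Sum>S\<in>?C. card (V - S))"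
    using finite_conn_sets[OF assms(2)] assms(2) by (intro card_SigmaI) auto
  moreover have "card ?B = (\<Sum>T\<in>?C. card (\<Union>p\<in>T. sides E T p))"
    using finite_conn_sets[OF assms(2)] finU by (intro card_SigmaI) auto
  ultimately show ?thesis by simp
qed

text \<open>The complements add up to \<open>card V * N - W\<close>, the bounds
  \<open>2 * (card T - 1)\<close> to \<open>2 * W - 2 * N\<close>. Equality makes every bound sharp,
  in particular that for \<open>T = V\<close>, which leaves room for only two non-cut
  vertices.\<close>

lemma conn_sets_weight:
  assumes "sym E" "finite V" "conn_set E V"
  defines "N \<equiv> card (conn_sets E V)" and "W \<equiv> \<Sum>S\<in>conn_sets E V. card S"
  shows "(card V + 2) * N \<le> 3 * W"
    and "3 * W = (card V + 2) * N \<Longrightarrow> card (noncut E V) \<le> 2"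
proof -
  let ?C = "conn_sets E V"
  let ?u = "\<lambda>T. card (\<Union>p\<in>T. sides E T p)"
  have C: "T \<subseteq> V \<and> finite T \<and> conn_set E T \<and> 1 \<le> card T \<and> card T \<le> card V" if "T \<in> ?C" for T
  proof -
    have T: "T \<subseteq> V" "conn_set E T" using that by (auto simp: conn_sets_def)
    moreover have "finite T" using T(1) assms(2) finite_subset by blast
    moreover from this have "1 \<le> card T"
      using conn_set_nonempty[OF T(2)] by (simp add: Suc_le_eq card_gt_0_iff)
    ultimately show ?thesis using card_mono[OF assms(2) T(1)] by blast
  qed
  have fin: "finite ?C" using finite_conn_sets[OF assms(2)] .
  have "(\<Sum>S\<in>?C. card (V - S)) + W = (\<Sum>S\<in>?C. card V)"
    unfolding W_def sum.distrib[symmetric]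
    by (intro sum.cong) (use C in \<open>simp_all add: card_Diff_subset\<close>)
  then have 1: "(\<Sum>S\<in>?C. card (V - S)) + W = card V * N" by (simp add: N_def)
  \<comment> \<open>Subtraction on \<open>nat\<close> is truncated, so \<open>2 * N\<close> is added
    instead; every \<open>T\<close> here has at least one vertex.\<close>
  have "(\<Sum>T\<in>?C. 2 * (card T - 1)) + 2 * N = (\<Sum>T\<in>?C. 2 * (card T - 1) + 2)"
    unfolding sum.distrib N_def by simp
  also have "\<dots> = (\<Sum>T\<in>?C. 2 * card T)" by (intro sum.cong) (use C in fastforce)+
  finally have 2: "(\<Sum>T\<in>?C. 2 * (card T - 1)) + 2 * N = 2 * W"
    by (simp add: W_def sum_distrib_left)
  have le: "?u T \<le> 2 * (card T - 1)" if "T \<in> ?C" for T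
    using card_sides_Union(2)[OF assms(1)] C[OF that] by blast
  have 3: "(\<Sum>S\<in>?C. card (V - S)) \<le> (\<Sum>T\<in>?C. ?u T)" using sum_complements_le[OF assms(1-3)] .
  show "(card V + 2) * N \<le> 3 * W"
    using 1 2 3 sum_mono[of ?C ?u, OF le] by (simp add: algebra_simps)
  assume "3 * W = (card V + 2) * N"
  then have ge: "(\<Sum>T\<in>?C. 2 * (card T - 1)) \<le> (\<Sum>T\<in>?C. ?u T)"
    using 1 2 3 by (simp add: algebra_simps)
  have "V \<in> ?C" using assms(3) by (simp add: conn_sets_def)
  have "\<not> ?u V < 2 * (card V - 1)"
  proof
    assume "?u V < 2 * (card V - 1)"
    then have "(\<Sum>T\<in>?C. ?u T) < (\<Sum>T\<in>?C. 2 * (card T - 1))"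
      using fin le \<open>V \<in> ?C\<close> by (intro sum_strict_mono_ex1) auto
    then show False using ge by simp
  qed
  then show "card (noncut E V) \<le> 2"
    using card_sides_Union(1)[OF assms(1-3)] by linarith
qed

subsection \<open>Paths\<close>

text \<open>An isomorphism from the path of order \<open>n\<close> onto the graph that
  \<open>E\<close> induces on \<open>V\<close>. Keeping \<open>E\<close> fixed lets an induction
  vary only the vertex set.\<close>

definition path_enum :: "('a \<times> 'a) set \<Rightarrow> 'a set \<Rightarrow> nat \<Rightarrow> (nat \<Rightarrow> 'a) \<Rightarrow> bool" where
  "path_enum E V n f \<longleftrightarrow> bij_betw f {..<n} V \<and>
     (\<forall>i<n. \<forall>j<n. (f i, f j) \<in> E \<longleftrightarrow> j = Suc i \<or> i = Suc j)"

text \<open>Induction on the order, deleting the end \<open>v\<close>. The non-cut vertices of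
  \<open>T - {v}\<close> turn out to be \<open>u\<close> and the only neighbour \<open>y\<close> of
  \<open>v\<close>, so a path ending in \<open>y\<close> is extended by \<open>v\<close>. This is
  why the last vertex is prescribed.\<close>

lemma path_enum_of_noncut:
  assumes "sym E" "irrefl E" "finite T" "conn_set E T" "noncut E T = {u, v}" "u \<noteq> v"
  shows "\<exists>f. path_enum E T (card T) f \<and> f (card T - 1) = v"
  using assms(3-6)
proof (induction "card T" arbitrary: T v)
  case 0
  then show ?case using conn_set_nonempty by auto
next
  case (Suc m)
  have v: "v \<in> T" and u: "u \<in> T" and c: "conn_set E (T - {v})"
    using Suc.prems(3) by (auto simp: noncut_def)
  have m: "card (T - {v}) = m" using Suc.hyps(2) v Suc.prems(1) by simp
  have nE: "(w, w) \<notin> E" for w using assms(2) by (auto simp: irrefl_def)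
  have sw: "(x, y) \<in> E \<longleftrightarrow> (y, x) \<in> E" for x y using assms(1) by (auto dest: symD)
  have "\<exists>f. path_enum E T (Suc m) f \<and> f m = v"
  proof (cases "m \<ge> 2")
    \<comment> \<open>Base case: \<open>T\<close> consists of \<open>u\<close> and \<open>v\<close>,
      joined by connectivity. The induction hypothesis does not apply, as the single vertex of
      \<open>T - {v}\<close> is not non-cut.\<close>
    case False
    have "u \<in> T - {v}" using u Suc.prems(4) by blast
    moreover from this have "m \<noteq> 0" using m Suc.prems(1) card_gt_0_iff[of "T - {v}"] by auto
    ultimately have "m = 1" using False by linarith
    then have "card (T - {v}) = 1" using m by argo
    then obtain w where w: "T - {v} = {w}" by (rule card_1_singletonE)
    have "w = u" using \<open>u \<in> T - {v}\<close> unfolding w by (rule singletonD[symmetric])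
    have "T = insert v (T - {v})" using v by (rule insert_Diff[symmetric])
    then have T: "T = {u, v}" unfolding w \<open>w = u\<close> by (simp only: insert_commute)
    have "{u} \<subseteq> T" "{u} \<noteq> {}" "{u} \<noteq> T" using T Suc.prems(4) by auto
    then obtain a b where "a \<in> {u}" "b \<in> T - {u}" "(a, b) \<in> E"
      by (rule conn_set_edge[OF Suc.prems(2)])
    then have "(u, v) \<in> E" using T by auto
    then have "path_enum E T (Suc m) (\<lambda>i. if i = 0 then u else v)"
      using T Suc.prems(4) nE sw[of u v] \<open>m = 1\<close>
      by (auto simp: path_enum_def bij_betw_def inj_on_def less_Suc_eq)
    then show ?thesis using \<open>m = 1\<close> by (intro exI[of _ "\<lambda>i. if i = 0 then u else v"]) auto
  next
    case True
    let ?T = "T - {v}"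
    have "?T \<subseteq> T" "?T \<noteq> {}" "?T \<noteq> T" using v conn_set_nonempty[OF c] by auto
    then obtain y b where "y \<in> ?T" "b \<in> T - ?T" "(y, b) \<in> E"
      by (rule conn_set_edge[OF Suc.prems(2)])
    then have y: "y \<in> ?T" "(y, v) \<in> E" by auto
    \<comment> \<open>A vertex that is non-cut in \<open>T - v\<close> but cut in \<open>T\<close> is the only neighbour of \<open>v\<close>.\<close>
    have sub: "w = u \<or> (\<forall>z\<in>?T. (z, v) \<in> E \<longrightarrow> z = w)" if w: "w \<in> noncut E ?T" for w
    proof (rule ccontr)
      assume "\<not> ?thesis"
      then obtain z where z: "w \<noteq> u" "z \<in> ?T" "(z, v) \<in> E" "z \<noteq> w" by blast
      have w': "w \<in> ?T" "conn_set E (?T - {w})" using w by (auto simp: noncut_def)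
      then have "conn_set E (insert v (?T - {w}))"
        using conn_set_insert[OF assms(1) w'(2), of z v] z by blast
      moreover have "insert v (?T - {w}) = T - {w}" using v w' by auto
      ultimately have "w \<in> noncut E T" using w' by (auto simp: noncut_def)
      then show False using Suc.prems(3) w' z(1) by auto
    qed
    have two: "card (noncut E ?T) \<ge> 2"
      using card_noncut_ge_2[OF assms(1) _ c] Suc.prems(1) m True by auto
    have suby: "noncut E ?T \<subseteq> {u, y}" using sub y by blast
    have "noncut E ?T = {u, y} \<and> u \<noteq> y"
    proof (rule ccontr)
      assume n: "\<not> ?thesis"
      have "card (noncut E ?T) \<le> 1"
      proof (cases "u = y")
        case True
        then show ?thesis using card_mono[OF _ suby] by simp
      next
        case False
        then have "noncut E ?T \<subset> {u, y}" using n suby by blast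
        then have "card (noncut E ?T) < card {u, y}" by (intro psubset_card_mono) auto
        then show ?thesis using False by simp
      qed
      then show False using two by simp
    qed
    then have nc: "noncut E ?T = {u, y}" "u \<noteq> y" by auto
    then have only: "z = y" if "z \<in> ?T" "(z, v) \<in> E" for z using sub[of y] that by blast
    obtain f where f: "path_enum E ?T m f" "f (m - 1) = y"
      using Suc.hyps(1)[OF m[symmetric] _ c nc] Suc.prems(1) m by auto
    have bij: "bij_betw f {..<m} ?T" using f by (simp add: path_enum_def)
    let ?g = "f(m := v)"
    have "bij_betw ?g {..<m} ?T" using bij by (rule bij_betw_cong[THEN iffD1, rotated]) auto
    then have "bij_betw ?g ({..<m} \<union> {m}) (?T \<union> {?g m})"
      by (intro notIn_Un_bij_betw) auto
    moreover have "{..<m} \<union> {m} = {..<Suc m}" "?T \<union> {?g m} = T" using v by auto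
    ultimately have "bij_betw ?g {..<Suc m} T" by simp
    \<comment> \<open>The only neighbour \<open>y\<close> of \<open>v\<close> has index
      \<open>m - 1\<close>.\<close>
    moreover have fv: "(f i, v) \<in> E \<longleftrightarrow> m = Suc i" if "i < m" for i
    proof -
      have fi: "f i \<in> ?T" using bij that by (auto simp: bij_betw_def)
      have "(f i, v) \<in> E \<longleftrightarrow> f i = y" using only[OF fi] y by blast
      also have "\<dots> \<longleftrightarrow> i = m - 1"
        using f(2) bij that True by (auto simp: bij_betw_def inj_on_def)
      also have "\<dots> \<longleftrightarrow> m = Suc i" using that by auto
      finally show ?thesis .
    qed
    have "(?g i, ?g j) \<in> E \<longleftrightarrow> j = Suc i \<or> i = Suc j" if "i < Suc m" "j < Suc m" for i j
      using that f(1) fv[of i] fv[of j] nE sw[of v "f j"]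
      by (auto simp: path_enum_def less_Suc_eq)
    ultimately have "path_enum E T (Suc m) ?g" by (auto simp: path_enum_def)
    then show ?thesis by (intro exI[of _ ?g]) auto
  qed
  then show ?case using Suc.hyps(2) by (metis diff_Suc_1)
qed

text \<open>For at least two vertices the bounds from both sides leave exactly two non-cut vertices.
  A single vertex is treated separately.\<close>

lemma path_enum_of_equality:
  assumes "sym E" "irrefl E" "finite V" "conn_set E V"
    and "3 * (\<Sum>S\<in>conn_sets E V. card S) = (card V + 2) * card (conn_sets E V)"
  shows "\<exists>f. path_enum E V (card V) f"
proof (cases "card V \<ge> 2")
  case True
  have "card (noncut E V) = 2"
    using conn_sets_weight(2)[OF assms(1,3,4,5)] card_noncut_ge_2[OF assms(1,3,4) True] by linarith
  then obtain u v where "noncut E V = {u, v}" "u \<noteq> v" by (auto simp: card_2_iff)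
  then show ?thesis using path_enum_of_noncut[OF assms(1-4)] by blast
next
  case False
  have "card V \<noteq> 0" using assms(3) conn_set_nonempty[OF assms(4)] by auto
  then have "card V = 1" using False by linarith
  then obtain v where "V = {v}" by (auto simp: card_1_singleton_iff)
  moreover have "(v, v) \<notin> E" using assms(2) by (auto simp: irrefl_def)
  ultimately have "path_enum E V (card V) (\<lambda>_. v)"
    by (auto simp: path_enum_def bij_betw_def inj_on_def)
  then show ?thesis by blast
qed

text \<open>An edge changes the index by one, so a connected set cannot skip an index. The pairs
  carry the upper end first because the range of the lower end depends on it.\<close>

lemma path_conn_sets:
  assumes "sym E" "path_enum E V n f"
  shows "conn_sets E V = (\<lambda>(b, a). f ` {a..b}) ` (SIGMA b:{..<n}. {..b})"
proof (intro equalityI subsetI)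
  have bij: "bij_betw f {..<n} V" using assms(2) by (simp add: path_enum_def)
  have adj: "(f i, f j) \<in> E \<longleftrightarrow> j = Suc i \<or> i = Suc j" if "i < n" "j < n" for i j
    using assms(2) that by (simp add: path_enum_def)
  fix S
  {
    assume "S \<in> (\<lambda>(b, a). f ` {a..b}) ` (SIGMA b:{..<n}. {..b})"
    then obtain a b where ab: "S = f ` {a..b}" "a \<le> b" "b < n" by auto
    have "conn_set E (f ` {a..b})" using ab(2,3)
    proof (induction b rule: dec_induct)
      case (step k)
      have "conn_set E (insert (f (Suc k)) (f ` {a..k}))"
        using step adj[of k "Suc k"] by (intro conn_set_insert[OF assms(1), of _ "f k"]) auto
      moreover have "{a..Suc k} = insert (Suc k) {a..k}" using step by auto
      ultimately show ?case by simp
    qed simp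
    moreover have "f ` {a..b} \<subseteq> V" using bij ab by (auto simp: bij_betw_def)
    ultimately show "S \<in> conn_sets E V" using ab by (simp add: conn_sets_def)
  next
    assume "S \<in> conn_sets E V"
    then have S: "S \<subseteq> V" "conn_set E S" by (auto simp: conn_sets_def)
    define I where "I = {i. i < n \<and> f i \<in> S}"
    have SI: "S = f ` I" using S(1) bij by (auto simp: I_def bij_betw_def)
    have I: "finite I" "I \<noteq> {}" using SI conn_set_nonempty[OF S(2)] by (auto simp: I_def)
    have bI: "Max I \<in> I" and aI: "Min I \<in> I" using I by auto
    \<comment> \<open>If \<open>k\<close> were missing, the vertices of \<open>S\<close> with index
      below \<open>k\<close> would form a closed part without \<open>f (Max I)\<close>.\<close>
    have mid: "k \<in> I" if k: "Min I \<le> k" "k \<le> Max I" for k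
    proof (rule ccontr)
      assume "k \<notin> I"
      let ?A = "f ` {i \<in> I. i < k}"
      have "Min I < k" using k(1) aI \<open>k \<notin> I\<close> by (metis le_neq_implies_less)
      then have ne: "?A \<inter> S \<noteq> {}" using aI SI by auto
      have cl: "(x, y) \<notin> E" if xy: "x \<in> ?A \<inter> S" "y \<in> S - ?A" for x y
      proof -
        obtain i where i: "x = f i" "i \<in> I" "i < k" using xy(1) by blast
        obtain j where j: "y = f j" "j \<in> I" using xy(2) SI by blast
        then have "\<not> j < k" using xy(2) by blast
        then have "k < j" using \<open>k \<notin> I\<close> j by (metis linorder_neqE_nat)
        then show ?thesis using adj[of i j] i j by (simp add: I_def)
      qed
      have "S \<subseteq> ?A" using conn_set_closed[OF S(2) ne cl] by blast
      moreover have "f (Max I) \<in> S" using bI SI by blast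
      ultimately obtain i where i: "f (Max I) = f i" "i \<in> I" "i < k" by blast
      then have "Max I = i" using bij bI by (auto simp: I_def bij_betw_def inj_on_def)
      then show False using i k by simp
    qed
    have "I \<subseteq> {Min I..Max I}" using I(1) by (intro subsetI) simp
    moreover have "{Min I..Max I} \<subseteq> I" using mid by (intro subsetI) (simp only: atLeastAtMost_iff)
    ultimately have "I = {Min I..Max I}" by (rule equalityI)
    then have "f ` I = f ` {Min I..Max I}" by (rule arg_cong)
    then have "S = (\<lambda>(b, a). f ` {a..b}) (Max I, Min I)" unfolding SI by (simp only: case_prod_conv)
    moreover have "I \<subseteq> {..<n}" by (auto simp: I_def)
    then have "(Max I, Min I) \<in> (SIGMA b:{..<n}. {..b})" using I bI by auto
    ultimately show "S \<in> (\<lambda>(b, a). f ` {a..b}) ` (SIGMA b:{..<n}. {..b})" by (rule image_eqI)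
  }
qed

text \<open>There are \<open>n * (n + 1) / 2\<close> intervals, of total size
  \<open>n * (n + 1) * (n + 2) / 6\<close>. The proof handles \<open>2\<close> and \<open>6\<close>
  times these numbers to stay in \<open>nat\<close>.\<close>

lemma path_weight:
  assumes "sym E" "path_enum E V n f"
  shows "3 * (\<Sum>S\<in>conn_sets E V. card S) = (n + 2) * card (conn_sets E V)"
proof -
  let ?I = "SIGMA b:{..<n}. {..b}" and ?g = "\<lambda>(b, a). f ` {a..b}"
  have inj: "inj_on f {..<n}" using assms(2) by (simp add: path_enum_def bij_betw_def)
  have "inj_on ?g ?I"
  proof (rule inj_onI)
    fix p q assume pq: "p \<in> ?I" "q \<in> ?I" "?g p = ?g q"
    obtain b a b' a' where [simp]: "p = (b, a)" "q = (b', a')" by force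
    have "{a..b} \<subseteq> {..<n}" "{a'..b'} \<subseteq> {..<n}" using pq by auto
    then have "{a..b} = {a'..b'}" using inj pq(3) by (simp add: inj_on_image_eq_iff)
    then show "p = q" using pq(1,2) by (auto simp: Icc_eq_Icc)
  qed
  then have N: "card (conn_sets E V) = card ?I"
    and "(\<Sum>S\<in>conn_sets E V. card S) = (\<Sum>p\<in>?I. card (?g p))"
    unfolding path_conn_sets[OF assms] by (simp_all add: card_image sum.reindex)
  note this(2)
  also have "(\<Sum>p\<in>?I. card (?g p)) = (\<Sum>(b, a)\<in>?I. Suc b - a)"
  proof (intro sum.cong refl)
    fix p assume p: "p \<in> ?I"
    obtain b a where [simp]: "p = (b, a)" by force
    have "inj_on f {a..b}" using p by (auto intro: inj_on_subset[OF inj])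
    then show "card (?g p) = (case p of (b, a) \<Rightarrow> Suc b - a)" by (simp add: card_image)
  qed
  also have "\<dots> = (\<Sum>b<n. \<Sum>a\<le>b. Suc b - a)" by (subst sum.Sigma) auto
  finally have W: "(\<Sum>S\<in>conn_sets E V. card S) = (\<Sum>b<n. \<Sum>a\<le>b. Suc b - a)" .
  have inner: "2 * (\<Sum>a\<le>b. Suc b - a) = (b + 1) * (b + 2)" for b :: nat
  proof -
    have "(\<Sum>a\<le>b. Suc b - a) = (\<Sum>a\<le>b. Suc a)"
      by (rule sum.reindex_bij_witness[of _ "\<lambda>a. b - a" "\<lambda>a. b - a"]) auto
    moreover have "2 * (\<Sum>a\<le>b. Suc a) = (b + 1) * (b + 2)" by (induction b) auto
    ultimately show ?thesis by simp
  qed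
  have "card ?I = (\<Sum>b<n. b + 1)" by (subst card_SigmaI) auto
  then have 2: "2 * card ?I = n * (n + 1)" by (simp add: sum.distrib) (induction n, auto)
  have "6 * (\<Sum>b<n. \<Sum>a\<le>b. Suc b - a) = n * (n + 1) * (n + 2)"
  proof (induction n)
    case (Suc n)
    have "6 * (\<Sum>b<Suc n. \<Sum>a\<le>b. Suc b - a) = n * (n + 1) * (n + 2) + 3 * ((n + 1) * (n + 2))"
      using Suc inner[of n] by (simp add: distrib_left del: mult_Suc sum.lessThan_Suc) (simp add: algebra_simps)
    then show ?case by (simp add: algebra_simps)
  qed simp
  then have "2 * (3 * (\<Sum>S\<in>conn_sets E V. card S)) = (n + 2) * (2 * card (conn_sets E V))"
    unfolding W N 2 by simp
  then show ?thesis by simp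
qed

subsection \<open>Connected induced subgraphs\<close>

text \<open>In a symmetric digraph connectedness is mutual reachability. A walk cannot leave a set
  without outgoing arcs, and conversely the set reachable from a vertex has none.\<close>

lemma connected_iff_conn_set:
  assumes "wf_digraph H" "symmetric H"
  shows "Digraph_Component.connected H \<longleftrightarrow> conn_set (arcs_ends H) (verts H)"
proof -
  interpret wf_digraph H by fact
  have "Digraph_Component.connected H \<longleftrightarrow> verts H \<noteq> {} \<and> (\<forall>u\<in>verts H. \<forall>v\<in>verts H. u \<rightarrow>\<^sup>*\<^bsub>H\<^esub> v)"
    using reachable_mk_symmetric_eq[OF assms(2)]
    by (simp add: Digraph_Component.connected_def strongly_connected_def)
  also have "\<dots> \<longleftrightarrow> conn_set (arcs_ends H) (verts H)"
  proof
    assume c: "verts H \<noteq> {} \<and> (\<forall>u\<in>verts H. \<forall>v\<in>verts H. u \<rightarrow>\<^sup>*\<^bsub>H\<^esub> v)"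
    have "verts H \<subseteq> A" if A: "A \<subseteq> verts H" "A \<noteq> {}" "\<forall>a\<in>A. \<forall>b\<in>verts H - A. (a, b) \<notin> arcs_ends H" for A
    proof
      fix v assume v: "v \<in> verts H"
      obtain u where u: "u \<in> A" using A(2) by blast
      then have "u \<rightarrow>\<^sup>*\<^bsub>H\<^esub> v" using c v A(1) by blast
      then show "v \<in> A"
        by (induction rule: reachable_induct) (use u A(3) in \<open>auto dest: adj_in_verts\<close>)
    qed
    then show "conn_set (arcs_ends H) (verts H)" using c unfolding conn_set_def by blast
  next
    assume c: "conn_set (arcs_ends H) (verts H)"
    have "u \<rightarrow>\<^sup>*\<^bsub>H\<^esub> v" if "u \<in> verts H" "v \<in> verts H" for u v
    proof -
      have "verts H \<subseteq> {w. u \<rightarrow>\<^sup>*\<^bsub>H\<^esub> w}"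
        by (rule conn_set_closed[OF c]) (use that in \<open>auto intro: reachable_adj_trans\<close>)
      then show ?thesis using that by blast
    qed
    then show "verts H \<noteq> {} \<and> (\<forall>u\<in>verts H. \<forall>v\<in>verts H. u \<rightarrow>\<^sup>*\<^bsub>H\<^esub> v)"
      using conn_set_nonempty[OF c] by blast
  qed
  finally show ?thesis .
qed

lemma conn_set_restrict: "conn_set (E \<inter> S \<times> S) S \<longleftrightarrow> conn_set E S"
  unfolding conn_set_def by (rule conj_cong[OF refl], rule all_cong1) blast

lemma graph_arcs_ends:
  assumes "graph G"
  shows "sym (arcs_ends G)" "irrefl (arcs_ends G)" "finite (verts G)"
proof -
  interpret graph G by fact
  show "sym (arcs_ends G)" using sym_arcs by (simp add: symmetric_def)
  show "irrefl (arcs_ends G)" by (auto simp: irrefl_def dest: adj_not_same)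
  show "finite (verts G)" by simp
qed

text \<open>An induced subgraph is determined by its vertex set, so counting subgraphs becomes
  counting connected sets.\<close>

lemma cis_eq_image:
  assumes "graph G"
  shows "cis G = (\<lambda>S. G \<restriction> S) ` conn_sets (arcs_ends G) (verts G)"
proof -
  interpret graph G by fact
  have conn: "Digraph_Component.connected (G \<restriction> S) \<longleftrightarrow> conn_set (arcs_ends G) S" if "S \<subseteq> verts G" for S
  proof -
    have "arcs_ends (G \<restriction> S) = arcs_ends G \<inter> S \<times> S" by (auto simp: arcs_ends_conv)
    moreover have "symmetric (G \<restriction> S)"
      using induced_graph_imp_symmetric[OF sym_arcs induced_induce[OF that]] .
    ultimately show ?thesis
      using connected_iff_conn_set[of "G \<restriction> S"] conn_set_restrict wellformed_induce_subgraph by simp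
  qed
  have eq: "H = G \<restriction> verts H" "verts H \<subseteq> verts G" if "induced_subgraph H G" for H
  proof -
    show "verts H \<subseteq> verts G" using that by blast
    then show "H = G \<restriction> verts H"
      using induced_eq_verts_imp_eq[OF that induced_induce] by simp
  qed
  show ?thesis
  proof (intro equalityI subsetI)
    fix H assume "H \<in> cis G"
    then have "induced_subgraph H G" "Digraph_Component.connected H" by (auto simp: cis_def)
    then show "H \<in> (\<lambda>S. G \<restriction> S) ` conn_sets (arcs_ends G) (verts G)"
      using eq[of H] conn[of "verts H"] by (intro image_eqI[of _ _ "verts H"]) (auto simp: conn_sets_def)
  next
    fix H assume "H \<in> (\<lambda>S. G \<restriction> S) ` conn_sets (arcs_ends G) (verts G)"
    then show "H \<in> cis G" using conn induced_induce by (auto simp: conn_sets_def cis_def)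
  qed
qed

lemma
  assumes "graph G"
  shows cis_number_conv: "cis_number G = card (conn_sets (arcs_ends G) (verts G))"
    and cis_weight_conv: "cis_weight G = (\<Sum>S\<in>conn_sets (arcs_ends G) (verts G). card S)"
proof -
  have "inj (\<lambda>S. G \<restriction> S)" by (metis injI induce_subgraph_verts)
  then have inj: "inj_on (\<lambda>S. G \<restriction> S) A" for A by (rule inj_on_subset) simp
  show "cis_number G = card (conn_sets (arcs_ends G) (verts G))"
    unfolding cis_number_def cis_eq_image[OF assms] by (rule card_image[OF inj])
  show "cis_weight G = (\<Sum>S\<in>conn_sets (arcs_ends G) (verts G). card S)"
    unfolding cis_weight_def cis_eq_image[OF assms] by (simp add: sum.reindex[OF inj])
qed

subsection \<open>The path graph\<close>

lemma
  shows verts_path_graph [simp]: "verts (path_graph n) = {..<n}"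
    and arcs_path_graph: "arcs (path_graph n) = {(i, j). i < n \<and> j < n \<and> (j = Suc i \<or> i = Suc j)}"
    and arcs_ends_path_graph:
      "arcs_ends (path_graph n) = {(i, j). i < n \<and> j < n \<and> (j = Suc i \<or> i = Suc j)}"
    and tail_path_graph [simp]: "tail (path_graph n) = fst"
    and head_path_graph [simp]: "head (path_graph n) = snd"
  by (simp_all add: path_graph_def)

lemma graph_path_graph: "graph (path_graph n)"
proof -
  have "arcs (path_graph n) \<subseteq> {..<n} \<times> {..<n}" by (auto simp: arcs_path_graph)
  then have "finite (arcs (path_graph n))" using finite_subset by blast
  then show ?thesis
    by unfold_locales
      (auto simp: arcs_path_graph arcs_ends_path_graph arc_to_ends_def symmetric_def sym_def)
qed

lemma path_enum_path_graph: "path_enum (arcs_ends (path_graph n)) {..<n} n id"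
  by (auto simp: path_enum_def arcs_ends_path_graph)

lemma conn_set_path_graph:
  assumes "n > 0"
  shows "conn_set (arcs_ends (path_graph n)) {..<n}"
proof -
  have "id ` {0..n - 1} \<in> conn_sets (arcs_ends (path_graph n)) {..<n}"
    unfolding path_conn_sets[OF graph_arcs_ends(1)[OF graph_path_graph] path_enum_path_graph]
    using assms by (intro image_eqI[of _ _ "(n - 1, 0)"]) auto
  moreover have "id ` {0..n - 1} = {..<n}" using assms by auto
  ultimately show ?thesis by (simp add: conn_sets_def)
qed

text \<open>A block of the path has at most two vertices, and two are joined by an edge because the
  block is connected.\<close>

lemma block_graph_path_graph: "block_graph (path_graph n)"
  unfolding block_graph_def
proof (intro conjI allI impI graph_path_graph)
  fix B assume "block (path_graph n) B"
  then have sub: "subgraph B (path_graph n)" and gB: "graph B"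
    and conB: "Digraph_Component.connected B" and nocut: "\<And>v. \<not> cut_vertex B v"
    by (auto simp: block_def pre_digraph.max_subgraph_def)
  interpret graph B by fact
  have near: "y = Suc x \<or> x = Suc y" if "x \<rightarrow>\<^bsub>B\<^esub> y" for x y
    using arcs_ends_mono[OF sub] that by (auto simp: arcs_ends_path_graph)
  have conn: "conn_set (arcs_ends B) (verts B)"
    using connected_iff_conn_set[OF wf_digraph sym_arcs] conB by simp
  \<comment> \<open>The middle one of three vertices would be a cut vertex.\<close>
  have three: False if abc: "a \<in> verts B" "b \<in> verts B" "c \<in> verts B" "a < b" "b < c" for a b c
  proof -
    interpret D: wf_digraph "del_vert b" by (rule wf_digraph_del_vert)
    \<comment> \<open>Steps in \<open>B\<close> change a number by one and \<open>b\<close> is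
      deleted, so no walk starting below \<open>b\<close> gets past it.\<close>
    have "y < b" if "a \<rightarrow>\<^sup>*\<^bsub>del_vert b\<^esub> y" for y
      using that
    proof (induction rule: D.reachable_induct)
      case (step x y)
      have "x \<rightarrow>\<^bsub>B\<^esub> y" using arcs_ends_mono[OF subgraph_del_vert] step(2) by blast
      moreover have "y \<noteq> b" using D.adj_in_verts(2)[OF step(2)] by (simp add: verts_del_vert)
      ultimately show ?case using step(3) near[of x y] by auto
    qed (rule abc)
    then have "\<not> a \<rightarrow>\<^sup>*\<^bsub>del_vert b\<^esub> c" using abc(5) by force
    moreover have "a \<rightarrow>\<^sup>*\<^bsub>B\<^esub> c"
      using symmetric_connected_imp_strongly_connected[OF sym_arcs conB] abc by blast
    ultimately have "cut_vertex B b" using abc unfolding cut_vertex_def by blast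
    then show False using nocut by blast
  qed
  have "u \<rightarrow>\<^bsub>B\<^esub> v" if uv: "u \<in> verts B" "v \<in> verts B" "u \<noteq> v" for u v
  proof -
    \<comment> \<open>A third vertex could lie anywhere relative to \<open>u\<close> and
      \<open>v\<close>, hence the six instances.\<close>
    have "w = u \<or> w = v" if "w \<in> verts B" for w
      using three[of u v w] three[of u w v] three[of v u w] three[of v w u]
        three[of w u v] three[of w v u] uv that by (metis linorder_neqE_nat)
    then have V: "verts B = {u, v}" using uv by blast
    have "{u} \<subseteq> verts B" "{u} \<noteq> {}" "{u} \<noteq> verts B" using V uv(3) by auto
    then obtain a b where "a \<in> {u}" "b \<in> verts B - {u}" "(a, b) \<in> arcs_ends B"
      by (rule conn_set_edge[OF conn])
    then show ?thesis using V by auto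
  qed
  then have "arcs_ends B = {(u, v). (u, v) \<in> verts B \<times> verts B \<and> u \<noteq> v}"
    by (auto dest: adj_in_verts adj_not_same)
  then show "complete_digraph (card (verts B)) B" using gB by (simp add: complete_digraph_def)
qed

section \<open>Enumerations and isomorphisms with the path\<close>

text \<open>The enumeration is the inverse of the vertex part of the isomorphism.\<close>

lemma iso_path_graph_imp_path_enum:
  assumes "graph G" "digraph_iso G (path_graph n)"
  shows "\<exists>f. path_enum (arcs_ends G) (verts G) n f"
proof -
  interpret graph G by fact
  obtain h where h: "digraph_isomorphism h" "path_graph n = app_iso h G"
    using assms(2) by (auto simp: digraph_iso_def)
  let ?h = "iso_verts h"
  have "?h ` verts G = {..<n}" using arg_cong[OF h(2), of verts] by simp
  then have bij: "bij_betw ?h (verts G) {..<n}"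
    using h(1) by (simp add: bij_betw_def digraph_isomorphism_def)
  let ?f = "the_inv_into (verts G) ?h"
  have bf: "bij_betw ?f {..<n} (verts G)" using bij by (rule bij_betw_the_inv_into)
  have hf: "?h (?f i) = i" if "i < n" for i
    using f_the_inv_into_f_bij_betw[OF bij] that by simp
  have ends: "arcs_ends (path_graph n) = (\<lambda>(u, v). (?h u, ?h v)) ` arcs_ends G"
    using h by (auto simp: arcs_ends_conv iso_verts_tail iso_verts_head image_image)
  have "(?f i, ?f j) \<in> arcs_ends G \<longleftrightarrow> j = Suc i \<or> i = Suc j" if ij: "i < n" "j < n" for i j
  proof -
    have V: "?f i \<in> verts G" "?f j \<in> verts G" using bf ij by (auto simp: bij_betw_def)
    have "(?f i, ?f j) \<in> arcs_ends G \<longleftrightarrow> (i, j) \<in> arcs_ends (path_graph n)"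
    proof
      assume "(?f i, ?f j) \<in> arcs_ends G"
      then have "(?h (?f i), ?h (?f j)) \<in> arcs_ends (path_graph n)" unfolding ends by force
      then show "(i, j) \<in> arcs_ends (path_graph n)" using hf ij by simp
    next
      assume "(i, j) \<in> arcs_ends (path_graph n)"
      then obtain u v where uv: "(u, v) \<in> arcs_ends G" "i = ?h u" "j = ?h v" unfolding ends by auto
      then have "u \<in> verts G" "v \<in> verts G" by (auto dest: adj_in_verts)
      then have "?f i = u" "?f j = v"
        using uv bij by (auto simp: bij_betw_def the_inv_into_f_f)
      then show "(?f i, ?f j) \<in> arcs_ends G" using uv by simp
    qed
    then show ?thesis using ij by (simp add: arcs_ends_path_graph)
  qed
  then show ?thesis using bf by (auto simp: path_enum_def)
qed

text \<open>An arc goes to the pair of indices of its ends, which is how \<open>path_graph\<close>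
  encodes arcs; the renamed graph is then equal to \<open>path_graph n\<close>, with
  \<open>fst\<close> and \<open>snd\<close> as tail and head.\<close>

lemma path_enum_imp_iso_path_graph:
  assumes "graph G" "path_enum (arcs_ends G) (verts G) n f"
  shows "digraph_iso G (path_graph n)"
proof -
  interpret graph G by fact
  have bij: "bij_betw f {..<n} (verts G)" using assms(2) by (simp add: path_enum_def)
  have adj: "(f i, f j) \<in> arcs_ends G \<longleftrightarrow> j = Suc i \<or> i = Suc j" if "i < n" "j < n" for i j
    using assms(2) that by (simp add: path_enum_def)
  let ?h = "the_inv_into {..<n} f"
  let ?a = "\<lambda>e. (?h (tail G e), ?h (head G e))"
  let ?iso = "\<lparr>iso_verts = ?h, iso_arcs = ?a, iso_head = snd, iso_tail = fst\<rparr>"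
  have bh: "bij_betw ?h (verts G) {..<n}" using bij by (rule bij_betw_the_inv_into)
  then have inj: "inj_on ?h (verts G)" by (simp add: bij_betw_def)
  have fh: "f (?h v) = v" "?h v < n" if "v \<in> verts G" for v
    using f_the_inv_into_f_bij_betw[OF bij] that bh by (auto simp: bij_betw_def)
  \<comment> \<open>Arcs with the same ends coincide because there are no parallel arcs.\<close>
  have "inj_on ?a (arcs G)"
  proof (rule inj_onI)
    fix e e' assume e: "e \<in> arcs G" "e' \<in> arcs G" "?a e = ?a e'"
    then have "tail G e = tail G e'" "head G e = head G e'"
      using inj by (auto dest: inj_onD)
    then show "e = e'" using no_multi_arcs e by (simp add: arc_to_ends_def)
  qed
  then have iso: "digraph_isomorphism ?iso"
    using inj wf_digraph by (simp add: digraph_isomorphism_def)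
  have "?a ` arcs G = {(i, j). i < n \<and> j < n \<and> (j = Suc i \<or> i = Suc j)}"
  proof (intro equalityI subsetI)
    fix p assume "p \<in> ?a ` arcs G"
    then obtain e where e: "e \<in> arcs G" "p = ?a e" by blast
    then have lt: "?h (tail G e) < n" "?h (head G e) < n" using fh(2) by auto
    have "(f (?h (tail G e)), f (?h (head G e))) \<in> arcs_ends G"
      using e(1) fh(1) by (auto simp: arcs_ends_conv)
    then show "p \<in> {(i, j). i < n \<and> j < n \<and> (j = Suc i \<or> i = Suc j)}"
      using adj[OF lt] e(2) lt by simp
  next
    fix p assume "p \<in> {(i, j). i < n \<and> j < n \<and> (j = Suc i \<or> i = Suc j)}"
    then obtain i j where ij: "p = (i, j)" "i < n" "j < n" "j = Suc i \<or> i = Suc j" by blast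
    then obtain e where e: "e \<in> arcs G" "tail G e = f i" "head G e = f j"
      using adj[of i j] by (auto simp: arcs_ends_conv)
    have "?h (f k) = k" if "k < n" for k
      using bij that by (simp add: bij_betw_def the_inv_into_f_f)
    then have "p = ?a e" using e ij by simp
    then show "p \<in> ?a ` arcs G" using e by blast
  qed
  moreover have "?h ` verts G = {..<n}" using bh by (simp add: bij_betw_def)
  ultimately have "path_graph n = app_iso ?iso G"
    by (simp add: path_graph_def app_iso_def with_proj_def)
  then show ?thesis using iso by (auto simp: digraph_iso_def)
qed

section \<open>From the counts to the mean order\<close>

text \<open>The whole vertex set is counted, so the denominator of the mean is nonzero.\<close>

lemma cis_number_pos:
  assumes "graph H" "conn_set (arcs_ends H) (verts H)"
  shows "cis_number H > 0"
proof -
  have "verts H \<in> conn_sets (arcs_ends H) (verts H)" using assms(2) by (simp add: conn_sets_def)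
  then show ?thesis
    using finite_conn_sets[OF graph_arcs_ends(3)[OF assms(1)]]
    by (auto simp: cis_number_conv[OF assms(1)] card_gt_0_iff)
qed

text \<open>Clearing denominators moves both claims to natural numbers, where the counting was
  done.\<close>

lemma
  assumes "cis_number H > 0"
  shows mean_cis_order_ge_iff:
      "mean_cis_order H \<ge> (real m + 2) / 3 \<longleftrightarrow> (m + 2) * cis_number H \<le> 3 * cis_weight H"
    and mean_cis_order_eq_iff:
      "mean_cis_order H = (real m + 2) / 3 \<longleftrightarrow> 3 * cis_weight H = (m + 2) * cis_number H"
proof -
  have "mean_cis_order H \<ge> (real m + 2) / 3
      \<longleftrightarrow> real ((m + 2) * cis_number H) \<le> real (3 * cis_weight H)"
    using assms by (simp add: mean_cis_order_def field_simps)
  then show "mean_cis_order H \<ge> (real m + 2) / 3 \<longleftrightarrow> (m + 2) * cis_number H \<le> 3 * cis_weight H"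
    by (simp only: of_nat_le_iff)
  have "mean_cis_order H = (real m + 2) / 3
      \<longleftrightarrow> real (3 * cis_weight H) = real ((m + 2) * cis_number H)"
    using assms by (simp add: mean_cis_order_def field_simps)
  then show "mean_cis_order H = (real m + 2) / 3 \<longleftrightarrow> 3 * cis_weight H = (m + 2) * cis_number H"
    by (simp only: of_nat_eq_iff)
qed

theorem theorem3p1:
  fixes G :: "('a, 'b) pre_digraph" and n :: nat
  assumes "block_graph G" and "Digraph_Component.connected G" and "card (verts G) = n"
  shows "mean_cis_order G \<ge> (real n + 2) / 3
    \<and> (mean_cis_order G = (real n + 2) / 3 \<longleftrightarrow> digraph_iso G (path_graph n))
    \<and> block_graph (path_graph n) \<and> Digraph_Component.connected (path_graph n)
    \<and> card (verts (path_graph n)) = n \<and> mean_cis_order (path_graph n) = (real n + 2) / 3"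
proof -
  have G: "graph G" using assms(1) by (simp add: block_graph_def)
  note E = graph_arcs_ends[OF G]
  interpret graph G by fact
  have conn: "conn_set (arcs_ends G) (verts G)"
    using connected_iff_conn_set[OF wf_digraph sym_arcs] assms(2) by simp
  \<comment> \<open>Connectedness rules out the empty graph; \<open>path_graph n\<close> is
    connected only for positive \<open>n\<close>.\<close>
  have "n > 0" using assms(3) E(3) conn_set_nonempty[OF conn] by (auto simp: card_gt_0_iff)
  note pos = cis_number_pos[OF G conn]
  have "mean_cis_order G \<ge> (real n + 2) / 3"
    using conn_sets_weight(1)[OF E(1,3) conn] assms(3)
    unfolding mean_cis_order_ge_iff[OF pos] cis_number_conv[OF G] cis_weight_conv[OF G] by simp
  moreover have "mean_cis_order G = (real n + 2) / 3 \<longleftrightarrow> digraph_iso G (path_graph n)"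
  proof
    assume "mean_cis_order G = (real n + 2) / 3"
    then have "\<exists>f. path_enum (arcs_ends G) (verts G) (card (verts G)) f"
      unfolding mean_cis_order_eq_iff[OF pos] cis_number_conv[OF G] cis_weight_conv[OF G]
      using path_enum_of_equality[OF E conn] assms(3) by simp
    then show "digraph_iso G (path_graph n)" 
      using path_enum_imp_iso_path_graph[OF G] assms(3) by blast
  next
    assume "digraph_iso G (path_graph n)"
    then obtain f where "path_enum (arcs_ends G) (verts G) n f"
      using iso_path_graph_imp_path_enum[OF G] by blast
    from path_weight[OF E(1) this] show "mean_cis_order G = (real n + 2) / 3"
      unfolding mean_cis_order_eq_iff[OF pos] cis_number_conv[OF G] cis_weight_conv[OF G] .
  qed
  moreover have "mean_cis_order (path_graph n) = (real n + 2) / 3"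
  proof -
    note P = graph_path_graph[of n]
    have "cis_number (path_graph n) > 0"
      using cis_number_pos[OF P] conn_set_path_graph[OF \<open>n > 0\<close>] by simp
    from mean_cis_order_eq_iff[OF this] show ?thesis
      using path_weight[OF graph_arcs_ends(1)[OF P] path_enum_path_graph]
      by (simp only: cis_number_conv[OF P] cis_weight_conv[OF P] verts_path_graph)
  qed
  moreover have "Digraph_Component.connected (path_graph n)"
  proof -
    interpret P: graph "path_graph n" by (rule graph_path_graph)
    show ?thesis
      using connected_iff_conn_set[OF P.wf_digraph P.sym_arcs] conn_set_path_graph[OF \<open>n > 0\<close>] by simp
  qed
  ultimately show ?thesis using block_graph_path_graph by simp
qed

end
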